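(* Let $(\mu_k)_{k\in\mathbb{Z}}$ be a bi-sequence in $M^1(\mathbb{R}^d)$ and let $\phi$ be an invertible linear map on $\mathbb{R}^d$. Consider the equation $$\lambda_k=\mu_k*\phi(\lambda_{k-1}),\qquad k\in\mathbb{Z}.\tag{E}$$ If $(\lambda_k)$ and $(\rho_k)$ are fundamental solutions of (E), then there is a $v\in\mathbb{R}^d$ such that $\rho_k=\lambda_k*\phi^k(\delta_v)$ for all $k\in\mathbb{Z}$.
   Context: $M^1(\mathbb{R}^d)$ is the space of Borel probability measures on $\mathbb{R}^d$; $*$ is convolution, $\delta_x$ is the Dirac measure at $x$, and $\phi(\nu)$ is the image (push-forward) of $\nu$ under $\phi$. A solution of (E) is a bi-sequence $(\lambda_k)_{k\in\mathbb{Z}}$ in $M^1(\mathbb{R}^d)$ satisfying (E) for all $k\in\mathbb{Z}$. A solution $(\lambda_k)$ is fundamental if for each solution $(\nu_k)$ of (E) there is $\nu\in M^1(\mathbb{R}^d)$ such that $\nu_k=\lambda_k*\phi^k(\nu)$ for all $k\in\mathbb{Z}$. *)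

theory Defs
  imports "HOL-Probability.Probability"
begin

definition funpow_int :: "('a \<Rightarrow> 'a) \<Rightarrow> int \<Rightarrow> 'a \<Rightarrow> 'a" where
  "funpow_int f k = (if 0 \<le> k then f ^^ nat k else inv f ^^ nat (- k))"

text \<open>The Borel probability measures are the elements of \<^term>\<open>space (prob_algebra borel)\<close>, and
  \<^term>\<open>distr \<nu> borel f\<close> is the push-forward of \<open>\<nu>\<close> under \<open>f\<close>.\<close>

definition is_solution ::
  "(int \<Rightarrow> (real ^ 'd) measure) \<Rightarrow> (real ^ 'd \<Rightarrow> real ^ 'd) \<Rightarrow> (int \<Rightarrow> (real ^ 'd) measure) \<Rightarrow> bool" where
  "is_solution \<mu> \<phi> l \<longleftrightarrow>
     (\<forall>k. l k \<in> space (prob_algebra borel)) \<and>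
     (\<forall>k. l k = (\<mu> k \<star> distr (l (k - 1)) borel \<phi>))"

definition is_fundamental_solution ::
  "(int \<Rightarrow> (real ^ 'd) measure) \<Rightarrow> (real ^ 'd \<Rightarrow> real ^ 'd) \<Rightarrow> (int \<Rightarrow> (real ^ 'd) measure) \<Rightarrow> bool" where
  "is_fundamental_solution \<mu> \<phi> l \<longleftrightarrow>
     is_solution \<mu> \<phi> l \<and>
     (\<forall>n. is_solution \<mu> \<phi> n \<longrightarrow>
        (\<exists>\<nu> \<in> space (prob_algebra borel).
           \<forall>k. n k = (l k \<star> distr \<nu> borel (funpow_int \<phi> k))))"

end

theory Submission
  imports Defs
begin

text \<open>Two fundamental solutions \<open>l\<close> and \<open>\<rho>\<close> are convolution factors of each other, so at \<open>k = 0\<close>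
  we get \<open>l 0 = l 0 \<star> (\<nu>' \<star> \<nu>)\<close>. The characteristic function of every coordinate of \<open>l 0\<close> is
  nonzero near the origin and can be cancelled there; a distribution on the line whose
  characteristic function is \<open>1\<close> near the origin is concentrated at \<open>0\<close>. Hence
  \<open>\<nu>' \<star> \<nu>\<close> is the Dirac measure at \<open>0\<close>, which forces the factor \<open>\<nu>\<close> to be a Dirac measure.\<close>

text \<open>If the real part of \<open>char M t\<close> is 1, the nonnegative function
  \<open>1 - cos (t * x)\<close> has integral 0 and so vanishes almost everywhere. Arbitrarily small
  nonzero \<open>t\<close> then rule out every \<open>x\<close> other than 0.\<close>

lemma (in real_distribution) AE_eq_0_if_char_eq_1_near_0:
  assumes "e > 0" and char: "\<And>t. \<bar>t\<bar> < e \<Longrightarrow> char M t = 1"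
  shows "AE x in M. x = 0"
proof -
  have cos_eq_1: "AE x in M. cos (t * x) = 1" if "\<bar>t\<bar> < e" for t
  proof -
    have int: "integrable M (\<lambda>x. cos (t * x))"
      by (rule integrable_const_bound[where B = 1]) auto
    have "Re (char M t) = (\<integral>x. cos (t * x) \<partial>M)"
      unfolding char_def by (subst integral_Re[symmetric]) (auto intro!: integrable_iexp simp: Re_exp)
    with char[OF that] have "(\<integral>x. 1 - cos (t * x) \<partial>M) = 0"
      using int by (simp add: prob_space[simplified])
    then have "AE x in M. 1 - cos (t * x) = 0"
      using int by (subst (asm) integral_nonneg_eq_0_iff_AE) auto
    then show ?thesis by eventually_elim simp
  qed
  \<comment> \<open>The exceptional null set depends on \<open>t\<close>, so only countably many
    \<open>t\<close> are used. They tend to 0, and the summand 2 keeps them strictly below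
    \<open>e\<close>.\<close>
  have "AE x in M. \<forall>n::nat. cos (e / (real n + 2) * x) = 1"
    unfolding AE_all_countable
    using \<open>e > 0\<close> by (intro allI cos_eq_1) (simp add: divide_less_eq)
  then show ?thesis
  proof eventually_elim
    case (elim x)
    \<comment> \<open>This \<open>n\<close> brings the argument of the cosine into [0, 1), up to
      sign; there \<open>cos\<close> is injective.\<close>
    obtain n :: nat where n: "e * \<bar>x\<bar> < real n"
      using reals_Archimedean2 by blast
    define y where "y = \<bar>e / (real n + 2) * x\<bar>"
    have "y = e * \<bar>x\<bar> / (real n + 2)"
      using \<open>e > 0\<close> by (simp add: y_def abs_mult)
    also have "\<dots> < 1" using n by (simp add: field_simps)
    finally have "y < 1" .
    have "cos y = cos 0" using elim by (simp only: y_def cos_abs_real cos_zero)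
    moreover have "0 \<le> y" "y \<le> pi"
      using \<open>y < 1\<close> pi_gt3 by (simp add: y_def, linarith)
    ultimately have "y = 0"
      using cos_inj_pi[of y 0] by simp
    then show "x = 0" using \<open>e > 0\<close> by (auto simp: y_def)
  qed
qed

text \<open>Additivity of \<open>f\<close> splits the exponential into a product, and Fubini
  separates the integrals. Taking for \<open>f\<close> the inner product with a fixed vector reduces
  the problem to characteristic functions on the line.\<close>

lemma char_distr_convolution:
  fixes M N :: "'a::ordered_euclidean_space measure" and f :: "'a \<Rightarrow> real"
  assumes "prob_space M" "prob_space N"
    and [measurable_cong]: "sets M = sets borel" "sets N = sets borel"
    and [measurable]: "f \<in> borel_measurable borel"
    and add: "\<And>x y. f (x + y) = f x + f y"
  shows "char (distr (M \<star> N) borel f) t = char (distr M borel f) t * char (distr N borel f) t"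
proof -
  interpret M: prob_space M by fact
  interpret N: prob_space N by fact
  interpret pair_prob_space M N ..
  have "char (distr (M \<star> N) borel f) t = (CLINT z|M \<Otimes>\<^sub>M N. iexp (t * f (fst z + snd z)))"
    by (simp add: char_def convolution_def integral_distr split_beta)
  also have "\<dots> = (CLINT z|M \<Otimes>\<^sub>M N. (\<lambda>(x, y). iexp (t * f (x + y))) z)"
    by (simp add: split_beta)
  also have "\<dots> = (CLINT x|M. CLINT y|N. iexp (t * f (x + y)))"
    by (subst integral_fst'[symmetric]) (auto intro!: P.integrable_const_bound[where B = 1])
  also have "\<dots> = (CLINT x|M. CLINT y|N. iexp (t * f x) * iexp (t * f y))"
    by (simp add: add distrib_left exp_add)
  also have "\<dots> = char (distr M borel f) t * char (distr N borel f) t"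
    by (simp add: char_def integral_distr)
  finally show ?thesis .
qed

lemma AE_eq_0_if_convolution_fixed:
  fixes M N :: "'a::ordered_euclidean_space measure"
  assumes M: "prob_space M" and N: "prob_space N"
    and sets [measurable_cong]: "sets M = sets borel" "sets N = sets borel"
    and fixed: "M \<star> N = M"
  shows "AE x in N. x = 0"
proof -
  have "AE x in N. x \<bullet> b = 0" for b
  proof -
    let ?f = "\<lambda>x. x \<bullet> b"
    let ?M = "distr M borel ?f" and ?N = "distr N borel ?f"
    interpret M': real_distribution ?M
      using M by (intro prob_space.real_distribution_distr) auto
    interpret N': real_distribution ?N
      using N by (intro prob_space.real_distribution_distr) auto
    \<comment> \<open>\<open>char ?M\<close> is 1 at 0, so it can be cancelled from
      \<open>char ?M t = char ?M t * char ?N t\<close> for all \<open>t\<close> near 0.\<close>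
    have "continuous (at 0) (char ?M)" by (rule M'.isCont_char)
    then obtain e where e: "e > 0" "\<And>t. dist t 0 < e \<Longrightarrow> char ?M t \<noteq> 0"
      using continuous_at_avoid[of 0 "char ?M" 0] M'.char_zero by (auto simp: dist_commute)
    have "char ?N t = 1" if "\<bar>t\<bar> < e" for t
      using char_distr_convolution[OF M N sets, of ?f t] e(2)[of t] that
      by (simp add: fixed inner_add_left)
    then have "AE x in ?N. x = 0"
      using \<open>e > 0\<close> by (rule N'.AE_eq_0_if_char_eq_1_near_0[rotated])
    then show ?thesis by (subst (asm) AE_distr_iff) auto
  qed
  then have "AE x in N. \<forall>b\<in>Basis. x \<bullet> b = 0"
    by (intro AE_finite_allI) auto
  then show ?thesis
    by eventually_elim (simp add: euclidean_all_zero_iff)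
qed

lemma eq_return_if_AE_eq:
  assumes "prob_space M" "AE x in M. x = a" and sets: "sets M = sets borel"
  shows "M = return borel (a::'a::t1_space)"
proof (rule measure_eqI)
  interpret prob_space M by fact
  fix A assume A: "A \<in> sets M"
  have "emeasure M A = emeasure M (if a \<in> A then space M else {})"
  proof (rule emeasure_eq_AE)
    show "AE x in M. x \<in> A \<longleftrightarrow> x \<in> (if a \<in> A then space M else {})"
      using assms(2) AE_space by eventually_elim simp
  qed (use A in auto)
  then show "emeasure M A = emeasure (return borel a) A"
    using A sets emeasure_space_1 by simp
qed (simp add: sets)

text \<open>By Fubini, for almost every \<open>x\<close> the measure \<open>N\<close> is
  concentrated at \<open>c - x\<close>. Since \<open>M\<close> is a probability measure, at least
  one such \<open>x\<close> exists.\<close>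

lemma Dirac_if_convolution_AE_eq:
  fixes M N :: "'a::ordered_euclidean_space measure"
  assumes "prob_space M" "prob_space N"
    and [measurable_cong]: "sets M = sets borel" and sets: "sets N = sets borel"
    and AE: "AE z in M \<star> N. z = c"
  shows "\<exists>v. N = return borel v"
proof -
  note sets[measurable_cong]
  interpret M: prob_space M by fact
  interpret N: prob_space N by fact
  interpret pair_prob_space M N ..
  have "AE z in M \<Otimes>\<^sub>M N. (case z of (x, y) \<Rightarrow> x + y) = c"
    using AE unfolding convolution_def by (subst (asm) AE_distr_iff) auto
  then have "AE x in M. AE y in N. x + y = c"
    using AE_pair by fastforce
  then obtain x where "AE y in N. x + y = c"
    using eventually_happens'[OF M.ae_filter_bot] by blast
  then have "AE y in N. y = c - x"
    by eventually_elim (simp add: algebra_simps)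
  with \<open>prob_space N\<close> sets show ?thesis
    using eq_return_if_AE_eq by blast
qed

theorem proposition1p2:
  fixes \<mu> l \<rho> :: "int \<Rightarrow> (real ^ 'd) measure"
    and \<phi> :: "real ^ 'd \<Rightarrow> real ^ 'd"
  assumes "\<And>k. \<mu> k \<in> space (prob_algebra borel)"
    and "linear \<phi>" and "bij \<phi>"
    and "is_fundamental_solution \<mu> \<phi> l"
    and "is_fundamental_solution \<mu> \<phi> \<rho>"
  shows "\<exists>v. \<forall>k. \<rho> k = (l k \<star> distr (return borel v) borel (funpow_int \<phi> k))"
proof -
  have sol: "is_solution \<mu> \<phi> l" "is_solution \<mu> \<phi> \<rho>"
    using assms(4,5) by (auto simp: is_fundamental_solution_def)
  obtain \<nu> where \<nu>: "\<nu> \<in> space (prob_algebra borel)"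
      "\<And>k. \<rho> k = (l k \<star> distr \<nu> borel (funpow_int \<phi> k))"
    using assms(4) sol(2) unfolding is_fundamental_solution_def by blast
  obtain \<nu>' where \<nu>': "\<nu>' \<in> space (prob_algebra borel)"
      "\<And>k. l k = (\<rho> k \<star> distr \<nu>' borel (funpow_int \<phi> k))"
    using assms(5) sol(1) unfolding is_fundamental_solution_def by blast
  have prob: "prob_space (l 0)" "prob_space \<nu>" "prob_space \<nu>'"
    and sets: "sets (l 0) = sets borel" "sets \<nu> = sets borel" "sets \<nu>' = sets borel"
    using sol(1)[unfolded is_solution_def, THEN conjunct1] \<nu>(1) \<nu>'(1)
    by (simp_all add: space_prob_algebra)
  note fin = prob[THEN prob_space.finite_measure]
  have "distr \<nu> borel (funpow_int \<phi> 0) = \<nu>" "distr \<nu>' borel (funpow_int \<phi> 0) = \<nu>'"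
    using sets by (simp_all add: funpow_int_def id_def distr_id2)
  then have "l 0 = ((l 0 \<star> \<nu>) \<star> \<nu>')"
    using \<nu>(2)[of 0] \<nu>'(2)[of 0] by simp
  \<comment> \<open>The factors are swapped so that \<open>\<nu>\<close> stands on the right, the
    factor that \<open>Dirac_if_convolution_AE_eq\<close> identifies.\<close>
  also have "\<dots> = (l 0 \<star> (\<nu>' \<star> \<nu>))"
    using fin sets by (simp add: convolution_associative[symmetric] convolution_commutative[of \<nu> \<nu>'])
  finally have "(l 0 \<star> (\<nu>' \<star> \<nu>)) = l 0" by simp
  moreover have "prob_space (\<nu>' \<star> \<nu>)"
  proof -
    interpret pair_prob_space \<nu>' \<nu>
      using prob by (simp add: pair_prob_space_def pair_sigma_finite_def prob_space_imp_sigma_finite)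
    note sets[measurable_cong]
    show ?thesis
      unfolding convolution_def by (rule P.prob_space_distr) measurable
  qed
  ultimately have "AE x in \<nu>' \<star> \<nu>. x = 0"
    using prob sets by (intro AE_eq_0_if_convolution_fixed[of "l 0"]) auto
  then obtain v where "\<nu> = return borel v"
    using Dirac_if_convolution_AE_eq prob sets by blast
  \<comment> \<open>The same \<open>\<nu>\<close> serves every \<open>k\<close>, so identifying it
    from the equation at 0 is enough.\<close>
  with \<nu>(2) show ?thesis by blast
qed

end
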